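(* Let $S_1,\dots,S_q$ be a basis of a linear subspace $\mathcal S\subseteq\mathbb{R}^{m\times n}$, let $A=\sum_{i=1}^qa_iS_i\in\mathcal S$ with $a=[a_1,\dots,a_q]^\top$, and let $b\in\mathbb{R}^m$ be such that the genericity condition $\widetilde\sigma_n>\sigma_{n+1}$ holds. Let $x$ be the unique TLS solution, $r=b-Ax$, $P=A^\top A-\sigma_{n+1}^2I_n$, and $L\in\mathbb{R}^{k\times n}$ with $k\le n$. Put $\mathcal N_s=P^{-1}V$, $V=[v_1,\dots,v_q]$ with $v_i=S_i^\top r-\left[A^\top+\frac{2xr^\top}{1+x^\top x}\right]S_ix$, and $\mathcal H=P^{-1}\left[A^\top+\frac{2xr^\top}{1+x^\top x}\right]$. When the solution space $\mathbb{R}^k$ is equipped with the componentwise norm $$\|u\|_c=\min\{\omega:\ |u_i|\le\omega|(Lx)_i|,\ i=1,\dots,k\}=\max\{|u_i|/|(Lx)_i|,\ i=1,\dots,k\},$$ the structured componentwise condition number of $\Psi_s(a,b)=Lx$ is $$\kappa_{s,c}=\left\|D_{Lx}^\dagger\left(|L\mathcal N_s||a|+|L\mathcal H||b|\right)\right\|_\infty$$ $$=\left\|D_{Lx}^\dagger\left(\sum_{i=1}^q|a_i|\left|LP^{-1}\left(\left[A^\top+\frac{2xr^\top}{1+x^\top x}\right]S_ix-S_i^\top r\right)\right|+\left|LP^{-1}\left[A^\top+\frac{2xr^\top}{1+x^\top x}\right]\right||b|\right)\right\|_\infty .$$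
   Context: Let $m>n$. The total least squares (TLS) problem for $A\in\mathbb{R}^{m\times n}$, $b\in\mathbb{R}^m$ is to minimize $\|[A,b]-[\widehat A,\widehat b]\|_F$ over $[\widehat A,\widehat b]\in\mathbb{R}^{m\times(n+1)}$ with $\widehat b$ in the range of $\widehat A$; any $x$ with $\widehat A x=\widehat b$ for a minimizer is a TLS solution. Let $\widetilde\sigma_n$ be the smallest singular value of $A$ and $\sigma_{n+1}$ the smallest singular value of $[A,b]$. Under the genericity condition $\widetilde\sigma_n>\sigma_{n+1}$ there is a unique TLS solution $x$; it satisfies $(A^\top A-\sigma_{n+1}^2I_n)x=A^\top b$. $\Psi_s(a,b)=Lx$, where $x$ is the TLS solution for $A=\sum_ia_iS_i$ and $b$; it is defined on those $(a,b)\in\mathbb{R}^q\times\mathbb{R}^m$ satisfying the genericity condition. It is Fréchet differentiable there with derivative $\mathsf d\Psi_s(a,b)\cdot(\mathsf da,\mathsf db)=LP^{-1}V\,\mathsf da+LP^{-1}\left[A^\top+\frac{2xr^\top}{1+x^\top x}\right]\mathsf db$. Componentwise norm on the data space: $\|(\mathsf da,\mathsf db)\|_c=\min\{\omega\ge0:|\mathsf da|\le\omega|a|,\ |\mathsf db|\le\omega|b|\}$ (entrywise), and $=\infty$ if no such $\omega$ exists. The condition number is $\kappa_{s,c}=\max_{\|(\mathsf da,\mathsf db)\|_c=1}\|\mathsf d\Psi_s(a,b)\cdot(\mathsf da,\mathsf db)\|_{c}$, with the componentwise norm relative to $Lx$ on $\mathbb{R}^k$. Convention on zero components: if $(Lx)_i=0$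 for some $i$, it is assumed that the $i$th component of $\mathsf d\Psi_s(a,b)\cdot(\mathsf da,\mathsf db)$ vanishes for all perturbations of finite componentwise norm, and the quotient $0/0$ is read as $0$. $|\cdot|$ is the entrywise absolute value, $D_{Lx}$ is the diagonal matrix with diagonal $Lx$, and $\dagger$ is the Moore–Penrose inverse. *)

theory Defs
  imports "HOL-Analysis.Analysis"
begin

text \<open>
  On \<^typ>\<open>real^'n\<close>, \<^typ>\<open>real^'n^'m\<close> and products of such spaces, the library order and
  the library absolute value (class \<^class>\<open>ordered_euclidean_space\<close>) are entrywise, the norm of
  a matrix is the Frobenius norm, and \<^const>\<open>infnorm\<close> is the maximum norm.
\<close>

definition outer :: "real^'n \<Rightarrow> real^'m \<Rightarrow> real^'m^'n" where
  "outer x r = (\<chi> i j. x $ i * r $ j)"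

definition diag :: "real^'k \<Rightarrow> real^'k^'k" where
  "diag d = (\<chi> i j. if i = j then d $ i else 0)"

text \<open>The Moore--Penrose inverse, as the unique solution of the four Penrose equations.\<close>

definition pinv :: "real^'n^'m \<Rightarrow> real^'m^'n" where
  "pinv M = (THE X. M ** X ** M = M \<and> X ** M ** X = X \<and>
     transpose (M ** X) = M ** X \<and> transpose (X ** M) = X ** M)"

text \<open>
  The singular values are the nonnegative square roots of the eigenvalues of \<open>M\<^sup>T M\<close>. This is used
  only for matrices with at least as many rows as columns (otherwise \<open>M\<^sup>T M\<close> has an additional
  eigenvalue 0).
\<close>

definition is_singular_value :: "real^'n^'m \<Rightarrow> real \<Rightarrow> bool" where
  "is_singular_value M \<sigma> \<longleftrightarrow>
     0 \<le> \<sigma> \<and> (\<exists>v. v \<noteq> 0 \<and> (transpose M ** M) *v v = \<sigma>\<^sup>2 *\<^sub>R v)"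

definition smallest_singular_value :: "real^'n^'m \<Rightarrow> real" where
  "smallest_singular_value M = (LEAST \<sigma>. is_singular_value M \<sigma>)"

text \<open>The block matrix \<open>[A, b]\<close>; its last column has index \<^term>\<open>Inr ()\<close>.\<close>

definition augment :: "real^'n^'m \<Rightarrow> real^'m \<Rightarrow> real^('n + unit)^'m" where
  "augment A b = (\<chi> i j. case j of Inl l \<Rightarrow> A $ i $ l | Inr _ \<Rightarrow> b $ i)"

definition tls_generic :: "real^'n^'m \<Rightarrow> real^'m \<Rightarrow> bool" where
  "tls_generic A b \<longleftrightarrow> smallest_singular_value A > smallest_singular_value (augment A b)"

definition is_tls_minimizer ::
    "real^'n^'m \<Rightarrow> real^'m \<Rightarrow> real^'n^'m \<Rightarrow> real^'m \<Rightarrow> bool" where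
  "is_tls_minimizer A b A' b' \<longleftrightarrow> b' \<in> range ((*v) A') \<and>
     (\<forall>A'' b''. b'' \<in> range ((*v) A'') \<longrightarrow>
        norm (augment A b - augment A' b') \<le> norm (augment A b - augment A'' b''))"

definition is_tls_solution :: "real^'n^'m \<Rightarrow> real^'m \<Rightarrow> real^'n \<Rightarrow> bool" where
  "is_tls_solution A b x \<longleftrightarrow> (\<exists>A' b'. is_tls_minimizer A b A' b' \<and> A' *v x = b')"

definition tls_solution :: "real^'n^'m \<Rightarrow> real^'m \<Rightarrow> real^'n" where
  "tls_solution A b = (THE x. is_tls_solution A b x)"

definition structured :: "('q::finite \<Rightarrow> real^'n^'m) \<Rightarrow> real^'q \<Rightarrow> real^'n^'m" where
  "structured S a = (\<Sum>i\<in>UNIV. a $ i *\<^sub>R S i)"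

text \<open>
  The structured solution map is only meaningful for data satisfying the genericity condition;
  these data form an open set, so the values elsewhere do not affect its derivative.
\<close>

definition Psi ::
    "('q::finite \<Rightarrow> real^'n^'m) \<Rightarrow> real^'n^'k \<Rightarrow> (real^'q) \<times> (real^'m) \<Rightarrow> real^'k" where
  "Psi S L = (\<lambda>(a, b). L *v tls_solution (structured S a) b)"

abbreviation dPsi ::
    "('q::finite \<Rightarrow> real^'n^'m) \<Rightarrow> real^'n^'k \<Rightarrow> (real^'q) \<times> (real^'m) \<Rightarrow>
     (real^'q) \<times> (real^'m) \<Rightarrow> real^'k" where
  "dPsi S L d \<equiv> frechet_derivative (Psi S L) (at d)"

text \<open>
  The componentwise norm of \<open>u\<close> relative to \<open>w\<close>, with value \<open>\<infinity>\<close> if no admissible \<open>\<omega>\<close> exists. It is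
  used both on the data space, for \<open>u = (da, db)\<close> and \<open>w = (a, b)\<close>, and on the solution space.
\<close>

definition cnorm :: "'a::ordered_euclidean_space \<Rightarrow> 'a \<Rightarrow> ereal" where
  "cnorm w u =
     (if \<exists>\<omega>::real. 0 \<le> \<omega> \<and> \<bar>u\<bar> \<le> \<omega> *\<^sub>R \<bar>w\<bar>
      then ereal (LEAST \<omega>. 0 \<le> \<omega> \<and> \<bar>u\<bar> \<le> \<omega> *\<^sub>R \<bar>w\<bar>) else \<infinity>)"

text \<open>\<^const>\<open>Greatest\<close> renders the maximum: it determines a value only if the maximum is attained.\<close>

definition cond_sc ::
    "('q::finite \<Rightarrow> real^'n^'m) \<Rightarrow> real^'n^'k \<Rightarrow> real^'q \<Rightarrow> real^'m \<Rightarrow> ereal" where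
  "cond_sc S L a b =
     (GREATEST \<kappa>. \<exists>da db. cnorm (a, b) (da, db) = 1 \<and>
        \<kappa> = cnorm (Psi S L (a, b)) (dPsi S L (a, b) (da, db)))"

end

theory Submission
  imports Defs
begin

text \<open>
  Write \<open>C = [A, b]\<close> and let \<open>\<sigma>\<close> be its smallest singular value, which is the minimum of
  \<open>\<parallel>C z\<parallel> / \<parallel>z\<parallel>\<close>. A pair \<open>(A', b')\<close> is solved by \<open>y\<close> exactly when \<open>[A', b']\<close> annihilates
  \<open>z = (y, -1)\<close>, and the cheapest perturbation of \<open>C\<close> that annihilates \<open>z\<close> is of rank one and
  has Frobenius norm \<open>\<parallel>C z\<parallel> / \<parallel>z\<parallel>\<close>. So TLS solutions are the \<open>x\<close> for which \<open>(x, -1)\<close> attains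
  this minimum. Genericity makes the minimizing eigenspace of \<open>C\<^sup>T C\<close> a line not contained in
  the hyperplane of vectors with last component \<open>0\<close>, which yields existence and uniqueness
  (\<open>is_tls_solution_iff_optimal\<close>, \<open>tls_optimal_exists\<close>, \<open>tls_optimal_unique\<close>).

  The solution is a zero of \<open>G(A, b, x) = A\<^sup>T r + (r\<^sup>T r / (1 + x\<^sup>T x)) x\<close> with \<open>r = b - A x\<close>. At a
  solution the Rayleigh quotient \<open>r\<^sup>T r / (1 + x\<^sup>T x)\<close> is stationary in \<open>x\<close>, so
  \<open>\<partial>G/\<partial>x = - (A\<^sup>T A - \<sigma>\<^sup>2 I) = - P\<close>, and \<open>P\<close> is positive definite by genericity. Since the
  solution depends continuously on the data (\<open>isCont_tls_solution\<close>), implicit differentiation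
  gives its derivative \<open>P\<^sup>-\<^sup>1 \<partial>G/\<partial>(A, b)\<close> (\<open>tls_solution_has_derivative\<close>). Composing with
  \<open>a \<mapsto> \<Sum> a\<^sub>i S\<^sub>i\<close> and \<open>L\<close> yields the derivative \<open>L N da + L H db\<close> of \<open>\<Psi>\<^sub>s\<close>.

  Finally, under \<open>\<bar>da\<bar> \<le> \<bar>a\<bar>\<close> and \<open>\<bar>db\<bar> \<le> \<bar>b\<bar>\<close> each component of a linear map \<open>B da + K db\<close> is bounded by
  that of \<open>\<bar>B\<bar> \<bar>a\<bar> + \<bar>K\<bar> \<bar>b\<bar>\<close>, and a suitable choice of signs attains this bound in any prescribed
  component (\<open>Greatest_cnorm_linear\<close>). Dividing by the components of \<open>L x\<close> and taking the
  largest quotient gives the condition number.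
\<close>

section \<open>The smallest singular value as a minimum\<close>

lemma norm_matrix_vector_mult_le: "norm (M *v u) \<le> norm M * norm u" for M :: "real^'n^'m"
proof -
  have "norm (M *v u) \<le> L2_set (\<lambda>i. norm (M $ i) * norm u) UNIV"
    unfolding norm_vec_def[of "M *v u"]
    by (rule L2_set_mono) (auto simp: matrix_vector_mul_component Cauchy_Schwarz_ineq2)
  also have "\<dots> = norm M * norm u"
    by (simp add: L2_set_left_distrib norm_vec_def[of M])
  finally show ?thesis .
qed

lemma gram_inner: "((transpose M ** M) *v u) \<bullet> w = (M *v u) \<bullet> (M *v w)" for M :: "real^'n^'m"
  by (metis dot_lmul_matrix matrix_vector_mul_assoc vector_transpose_matrix transpose_transpose)

text \<open>
  The form is minimal at \<open>v\<close>, so its directional derivative there must vanish; it suffices to look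
  in the direction \<open>f v\<close> itself.
\<close>

lemma psd_kernel:
  fixes f :: "'a::real_inner \<Rightarrow> 'a"
  assumes "linear f" and sym: "\<And>u w. f u \<bullet> w = u \<bullet> f w"
    and psd: "\<And>u. 0 \<le> f u \<bullet> u" and v: "f v \<bullet> v = 0"
  shows "f v = 0"
proof (rule ccontr)
  assume "f v \<noteq> 0"
  interpret linear f by fact
  define p where "p = f v \<bullet> f v"
  define q where "q = f (f v) \<bullet> f v"
  have p: "p > 0" using \<open>f v \<noteq> 0\<close> by (simp add: p_def)
  have q: "q \<ge> 0" using psd by (simp add: q_def)
  have *: "0 \<le> t\<^sup>2 * q - 2 * t * p" for t
  proof -
    have "f (v - t *\<^sub>R f v) \<bullet> (v - t *\<^sub>R f v) = t\<^sup>2 * q - 2 * t * p"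
      using v sym[of "f v" v]
      by (simp add: diff scale inner_diff p_def q_def power2_eq_square algebra_simps inner_commute)
    then show ?thesis using psd[of "v - t *\<^sub>R f v"] by simp
  qed
  \<comment> \<open>a step so short that the linear term dominates the quadratic one\<close>
  define t where "t = p / (q + 1)"
  have t: "t > 0" "t * (q + 1) = p" using p q by (auto simp: t_def)
  have "t\<^sup>2 * q - 2 * t * p = t * (t * q - 2 * p)" by (simp add: power2_eq_square algebra_simps)
  moreover have "t * q - 2 * p < 0" using t p by (simp add: algebra_simps)
  ultimately show False using *[of t] t(1) by (simp add: zero_le_mult_iff)
qed

text \<open>
  For a lower bound \<open>s\<close> of \<open>\<parallel>M u\<parallel> / \<parallel>u\<parallel>\<close>, \<open>M\<^sup>T M - s\<^sup>2 I\<close> is positive semidefinite, and the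
  vectors on which its form vanishes are its kernel.
\<close>

lemma gram_eigenvector_iff:
  fixes M :: "real^'n^'m"
  assumes "0 \<le> s" and lower: "\<And>u. s * norm u \<le> norm (M *v u)"
  shows "(transpose M ** M) *v v = s\<^sup>2 *\<^sub>R v \<longleftrightarrow> norm (M *v v) = s * norm v"
proof
  assume "(transpose M ** M) *v v = s\<^sup>2 *\<^sub>R v"
  then have "(M *v v) \<bullet> (M *v v) = s\<^sup>2 * (v \<bullet> v)" using gram_inner[of M v v] by simp
  then have "(norm (M *v v))\<^sup>2 = (s * norm v)\<^sup>2"
    by (simp add: power2_norm_eq_inner power_mult_distrib)
  then show "norm (M *v v) = s * norm v" using \<open>0 \<le> s\<close> by (simp add: power2_eq_iff_nonneg)
next
  assume eq: "norm (M *v v) = s * norm v"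
  let ?f = "\<lambda>u. (transpose M ** M) *v u - s\<^sup>2 *\<^sub>R u"
  have form: "?f u \<bullet> w = (M *v u) \<bullet> (M *v w) - s\<^sup>2 * (u \<bullet> w)" for u w
    by (simp add: inner_diff_left gram_inner)
  have quad: "?f u \<bullet> u = (norm (M *v u))\<^sup>2 - (s * norm u)\<^sup>2" for u
    by (simp add: form power2_norm_eq_inner power_mult_distrib)
  have "?f v = 0"
  proof (rule psd_kernel[where f = ?f])
    show "linear ?f" by (intro linear_compose_sub) (auto intro!: linear_compose_scale_right)
    show "?f u \<bullet> w = u \<bullet> ?f w" for u w
      unfolding form by (subst inner_commute, subst form) (simp add: inner_commute)
    show "0 \<le> ?f u \<bullet> u" for u
      unfolding quad using lower[of u] \<open>0 \<le> s\<close> by (simp add: power_mono)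
    show "?f v \<bullet> v = 0" unfolding quad eq by simp
  qed
  then show "(transpose M ** M) *v v = s\<^sup>2 *\<^sub>R v" by simp
qed

text \<open>
  By compactness \<open>\<parallel>M u\<parallel>\<close> attains its minimum on the unit sphere. A minimizer is an eigenvector of
  the Gram matrix, and every eigenvector provides a value of \<open>\<parallel>M u\<parallel> / \<parallel>u\<parallel>\<close>, so that the minimum is
  indeed the least singular value.
\<close>

lemma smallest_singular_value_attained:
  fixes M :: "real^'n^'m"
  shows smallest_singular_value_nonneg: "0 \<le> smallest_singular_value M"
    and smallest_singular_value_le: "smallest_singular_value M * norm u \<le> norm (M *v u)"
    and smallest_singular_value_witness:
      "\<exists>v. v \<noteq> 0 \<and> norm (M *v v) = smallest_singular_value M * norm v"
proof -
  have "\<exists>v\<in>sphere (0::real^'n) 1. \<forall>u\<in>sphere 0 1. norm (M *v v) \<le> norm (M *v u)"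
    by (intro continuous_attains_inf continuous_on_norm linear_continuous_on
        matrix_vector_mul_bounded_linear) auto
  then obtain v where v: "norm v = 1" and min: "\<And>u. norm u = 1 \<Longrightarrow> norm (M *v v) \<le> norm (M *v u)"
    by auto
  define s where "s = norm (M *v v)"
  have lower: "s * norm u \<le> norm (M *v u)" for u
  proof (cases "u = 0")
    case False
    have "s \<le> norm (M *v ((1 / norm u) *\<^sub>R u))" unfolding s_def using False by (intro min) simp
    also have "\<dots> = norm (M *v u) / norm u" by (simp add: matrix_vector_mult_scaleR)
    finally show ?thesis using False by (simp add: field_simps)
  qed simp
  have "s = smallest_singular_value M"
    unfolding smallest_singular_value_def
  proof (rule Least_equality[symmetric])
    have "0 \<le> s" by (simp add: s_def)
    then show "is_singular_value M s"
      unfolding is_singular_value_def using gram_eigenvector_iff[of s M v] lower v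
      by (metis mult.right_neutral norm_zero s_def zero_neq_one)
  next
    fix t assume "is_singular_value M t"
    then obtain w where t: "0 \<le> t" and w: "w \<noteq> 0" "(transpose M ** M) *v w = t\<^sup>2 *\<^sub>R w"
      by (auto simp: is_singular_value_def)
    have "(M *v w) \<bullet> (M *v w) = t\<^sup>2 * (w \<bullet> w)" using gram_inner[of M w w] w by simp
    then have "(norm (M *v w))\<^sup>2 = (t * norm w)\<^sup>2"
      by (simp add: power2_norm_eq_inner power_mult_distrib)
    then have "norm (M *v w) = t * norm w" using t by (simp add: power2_eq_iff_nonneg)
    then show "s \<le> t" using lower[of w] w by simp
  qed
  then show "0 \<le> smallest_singular_value M"
    and "smallest_singular_value M * norm u \<le> norm (M *v u)"
    and "\<exists>v. v \<noteq> 0 \<and> norm (M *v v) = smallest_singular_value M * norm v"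
    using lower v norm_ge_zero[of "M *v v"] by (auto simp: s_def intro!: exI[of _ v])
qed

text \<open>
  A minimizer of \<open>\<parallel>M' u\<parallel> / \<parallel>u\<parallel>\<close> is a competitor in the minimization for \<open>M\<close>.
\<close>

lemma smallest_singular_value_lipschitz:
  "smallest_singular_value M \<le> smallest_singular_value M' + norm (M - M')"
  for M M' :: "real^'n^'m"
proof -
  obtain v where v: "v \<noteq> 0" "norm (M' *v v) = smallest_singular_value M' * norm v"
    using smallest_singular_value_witness by blast
  have "smallest_singular_value M * norm v \<le> norm (M' *v v + (M - M') *v v)"
    using smallest_singular_value_le[of M v] by (simp add: matrix_vector_mult_diff_rdistrib)
  also have "\<dots> \<le> norm (M' *v v) + norm ((M - M') *v v)" by (rule norm_triangle_ineq)
  also have "\<dots> \<le> (smallest_singular_value M' + norm (M - M')) * norm v"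
    using v norm_matrix_vector_mult_le[of "M - M'" v] by (simp add: algebra_simps)
  finally show ?thesis using v by simp
qed

section \<open>Vectors and norms for the augmented matrix\<close>

definition extend :: "real^'n \<Rightarrow> real \<Rightarrow> real^('n + unit)" where
  "extend y t = (\<chi> j. case j of Inl l \<Rightarrow> y $ l | Inr _ \<Rightarrow> t)"

lemma extend_cases: obtains y t where "z = extend y t"
proof
  show "z = extend (\<chi> l. z $ Inl l) (z $ Inr ())"
    by (simp add: extend_def vec_eq_iff split: sum.split)
qed

lemma sum_UNIV_Plus_unit:
  "(\<Sum>j\<in>(UNIV :: ('n::finite + unit) set). f j) = (\<Sum>l\<in>UNIV. f (Inl l)) + f (Inr ())"
  for f :: "_ \<Rightarrow> real"
  unfolding UNIV_Plus_UNIV[symmetric] by (subst sum.Plus) (auto simp: UNIV_unit)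

lemma augment_mult_extend: "augment A b *v extend y t = A *v y + t *\<^sub>R b"
  by (simp add: vec_eq_iff matrix_vector_mult_def augment_def extend_def sum_UNIV_Plus_unit mult.commute)

lemma inner_extend: "extend y t \<bullet> extend y' t' = y \<bullet> y' + t * t'"
  by (simp add: inner_vec_def extend_def sum_UNIV_Plus_unit)

lemma norm_extend: "(norm (extend y t))\<^sup>2 = y \<bullet> y + t\<^sup>2"
  unfolding power2_norm_eq_inner inner_extend by (simp add: power2_eq_square)

lemma augment_diff: "augment A b - augment A' b' = augment (A - A') (b - b')"
  by (simp add: vec_eq_iff augment_def split: sum.split)

lemma norm_augment: "norm (augment A b) = norm (A, b)"
proof -
  have row: "augment A b $ i = extend (A $ i) (b $ i)" for i
    by (simp add: vec_eq_iff augment_def extend_def)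
  have "(norm (augment A b))\<^sup>2 = (norm A)\<^sup>2 + (norm b)\<^sup>2"
    by (simp add: power2_norm_eq_inner inner_vec_def[of "augment A b"] inner_vec_def[of A]
        inner_vec_def[of b] row inner_extend sum.distrib)
  then show ?thesis by (simp add: norm_Pair real_sqrt_unique)
qed

section \<open>Characterization of the total least squares solution\<close>

text \<open>
  The value of the TLS problem, once genericity holds.
\<close>

abbreviation tls_level :: "real^'n^'m \<Rightarrow> real^'m \<Rightarrow> real" where
  "tls_level A b \<equiv> smallest_singular_value (augment A b)"

lemma augment_mult_homogenized: "augment A b *v extend y (- 1) = A *v y - b"
  by (simp add: augment_mult_extend)

lemma norm_homogenized: "(norm (extend y (- 1)))\<^sup>2 = 1 + y \<bullet> y"
  by (simp add: norm_extend)

lemma norm_homogenized_pos: "0 < norm (extend y (- 1))"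
proof -
  have "0 < (norm (extend y (- 1)))\<^sup>2"
    unfolding norm_homogenized by (simp add: add_pos_nonneg)
  then show ?thesis by (metis norm_zero zero_less_norm_iff zero_power2 less_irrefl)
qed

text \<open>
  The homogenized vector \<open>(x, -1)\<close> minimizes the Rayleigh quotient of \<open>[A, b]\<close>.
\<close>

definition tls_optimal :: "real^'n^'m \<Rightarrow> real^'m \<Rightarrow> real^'n \<Rightarrow> bool" where
  "tls_optimal A b x \<longleftrightarrow> norm (A *v x - b) = tls_level A b * norm (extend x (- 1))"

lemma tls_level_le: "tls_level A b * norm (extend y (- 1)) \<le> norm (A *v y - b)"
  using smallest_singular_value_le[of "augment A b" "extend y (- 1)"]
  by (simp add: augment_mult_homogenized)

lemma tls_optimal_sq:
  assumes "tls_optimal A b x"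
  shows "(norm (A *v x - b))\<^sup>2 = (tls_level A b)\<^sup>2 * (1 + x \<bullet> x)"
  using assms by (simp add: tls_optimal_def power_mult_distrib norm_homogenized)

text \<open>
  This is the eigenvector equation for \<open>(x, -1)\<close>, tested against \<open>(y, t)\<close>.
\<close>

lemma tls_optimal_orthogonality:
  assumes "tls_optimal A b x"
  shows "(A *v x - b) \<bullet> (A *v y + t *\<^sub>R b) = (tls_level A b)\<^sup>2 * (x \<bullet> y - t)"
proof -
  let ?C = "augment A b" and ?z = "extend x (- 1)"
  have "norm (?C *v ?z) = tls_level A b * norm ?z"
    using assms by (simp add: tls_optimal_def augment_mult_homogenized)
  then have eig: "(transpose ?C ** ?C) *v ?z = (tls_level A b)\<^sup>2 *\<^sub>R ?z"
    by (subst gram_eigenvector_iff)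
      (auto simp: smallest_singular_value_nonneg smallest_singular_value_le)
  have "(A *v x - b) \<bullet> (A *v y + t *\<^sub>R b) = ((transpose ?C ** ?C) *v ?z) \<bullet> extend y t"
    by (simp add: gram_inner augment_mult_extend)
  also have "\<dots> = (tls_level A b)\<^sup>2 * (x \<bullet> y - t)"
    unfolding eig by (simp add: inner_extend)
  finally show ?thesis .
qed

text \<open>
  Since \<open>(y, -1) = (x, -1) + (y - x, 0)\<close> and \<open>(x, -1)\<close> lies in the kernel of \<open>C\<^sup>T C - \<sigma>\<^sup>2 I\<close>, the
  excess over the minimum is exactly the form of \<open>A\<^sup>T A - \<sigma>\<^sup>2 I\<close> at \<open>y - x\<close>. Under genericity this
  form is definite, which drives both uniqueness and continuity.
\<close>

lemma tls_residual_gap: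
  fixes A :: "real^'n^'m"
  assumes "tls_optimal A b x"
  shows "(norm (A *v y - b))\<^sup>2 = (tls_level A b)\<^sup>2 * (1 + y \<bullet> y) +
    ((norm (A *v (y - x)))\<^sup>2 - (tls_level A b)\<^sup>2 * (norm (y - x))\<^sup>2)"
proof -
  let ?s = "(tls_level A b)\<^sup>2" and ?h = "y - x" and ?r = "A *v x - b"
  have square: "(norm (u + w))\<^sup>2 = (norm u)\<^sup>2 + 2 * (u \<bullet> w) + (norm w)\<^sup>2" for u w :: "real^'m"
    by (simp add: power2_norm_eq_inner inner_add inner_commute)
  have "A *v y - b = ?r + A *v ?h" by (simp add: matrix_vector_mult_diff_distrib)
  then have "(norm (A *v y - b))\<^sup>2 = (norm ?r)\<^sup>2 + 2 * (?r \<bullet> (A *v ?h)) + (norm (A *v ?h))\<^sup>2"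
    by (simp only: square)
  also have "\<dots> = ?s * (1 + x \<bullet> x) + 2 * (?s * (x \<bullet> ?h)) + (norm (A *v ?h))\<^sup>2"
    using tls_optimal_sq[OF assms] tls_optimal_orthogonality[OF assms, of ?h 0] by simp
  also have "\<dots> = ?s * (1 + y \<bullet> y) + ((norm (A *v ?h))\<^sup>2 - ?s * (norm ?h)\<^sup>2)"
    by (simp add: power2_norm_eq_inner inner_diff inner_commute algebra_simps)
  finally show ?thesis .
qed

lemma generic_coercive:
  assumes "tls_generic A b"
  shows "(tls_level A b)\<^sup>2 < (smallest_singular_value A)\<^sup>2"
    and "(smallest_singular_value A)\<^sup>2 * (norm y)\<^sup>2 \<le> (norm (A *v y))\<^sup>2"
proof -
  show "(tls_level A b)\<^sup>2 < (smallest_singular_value A)\<^sup>2"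
    using assms by (intro power_strict_mono) (auto simp: tls_generic_def smallest_singular_value_nonneg)
  show "(smallest_singular_value A)\<^sup>2 * (norm y)\<^sup>2 \<le> (norm (A *v y))\<^sup>2"
    using power_mono[OF smallest_singular_value_le[of A y], of 2]
    by (simp add: power_mult_distrib smallest_singular_value_nonneg)
qed

lemma generic_definite:
  assumes "tls_generic A b" and "norm (A *v y) \<le> tls_level A b * norm y"
  shows "y = 0"
proof (rule ccontr)
  assume "y \<noteq> 0"
  have "smallest_singular_value A * norm y \<le> tls_level A b * norm y"
    using smallest_singular_value_le[of A y] assms(2) by linarith
  then show False using \<open>y \<noteq> 0\<close> assms(1) by (simp add: tls_generic_def)
qed

text \<open>
  A minimizer with last component \<open>0\<close> would yield a vector \<open>y \<noteq> 0\<close> with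
  \<open>\<parallel>A y\<parallel> = \<sigma> \<parallel>y\<parallel>\<close>, contrary to genericity; hence it can be scaled to have last component \<open>-1\<close>.
\<close>

lemma tls_optimal_exists:
  assumes "tls_generic A b"
  shows "\<exists>x. tls_optimal A b x"
proof -
  obtain z where z: "z \<noteq> 0" "norm (augment A b *v z) = tls_level A b * norm z"
    using smallest_singular_value_witness by blast
  obtain y t where yt: "z = extend y t" by (rule extend_cases)
  have "t \<noteq> 0"
  proof
    assume "t = 0"
    then have "norm z = norm y"
      using norm_extend[of y t] yt by (simp add: power2_norm_eq_inner[symmetric])
    then have "norm (A *v y) \<le> tls_level A b * norm y"
      using z yt \<open>t = 0\<close> by (simp add: augment_mult_extend)
    then have "y = 0" by (rule generic_definite[OF assms])
    then show False using z yt \<open>t = 0\<close> \<open>norm z = norm y\<close> by simp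
  qed
  define x where "x = (- 1 / t) *\<^sub>R y"
  have ext: "extend x (- 1) = (- 1 / t) *\<^sub>R z"
    using \<open>t \<noteq> 0\<close> by (simp add: x_def yt extend_def vec_eq_iff split: sum.split)
  have "A *v x - b = (- 1 / t) *\<^sub>R (augment A b *v z)"
    unfolding augment_mult_homogenized[symmetric] ext by (rule matrix_vector_mult_scaleR)
  then have "tls_optimal A b x"
    using z(2) by (simp add: tls_optimal_def ext)
  then show ?thesis ..
qed

lemma tls_optimal_unique:
  assumes "tls_generic A b" "tls_optimal A b x" "tls_optimal A b y"
  shows "x = y"
proof -
  have "(norm (A *v (y - x)))\<^sup>2 = (tls_level A b * norm (y - x))\<^sup>2"
    using tls_residual_gap[OF assms(2), of y] tls_optimal_sq[OF assms(3)]
    by (simp add: power_mult_distrib)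
  then have "norm (A *v (y - x)) \<le> tls_level A b * norm (y - x)"
    by (simp add: power2_eq_iff_nonneg smallest_singular_value_nonneg)
  from generic_definite[OF assms(1) this] show ?thesis by simp
qed

text \<open>
  A consistent system \<open>[A', b']\<close> annihilates \<open>(y, -1)\<close>, so the perturbation must reproduce the whole
  residual on this vector.
\<close>

lemma consistent_distance:
  assumes "A' *v y = b'"
  shows "norm (A *v y - b) \<le> norm (augment A b - augment A' b') * norm (extend y (- 1))"
proof -
  have "A *v y - b = (augment A b - augment A' b') *v extend y (- 1)"
    using assms by (simp add: matrix_vector_mult_diff_rdistrib augment_mult_homogenized)
  then show ?thesis by (simp add: norm_matrix_vector_mult_le)
qed

lemma norm_outer: "norm (outer u w) = norm u * norm w"
proof -
  have "(norm (outer u w))\<^sup>2 = (norm u * norm w)\<^sup>2"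
    by (simp add: power2_norm_eq_inner power_mult_distrib inner_vec_def outer_def
        sum_product mult.assoc mult.left_commute)
  then show ?thesis by (simp add: power2_eq_iff_nonneg)
qed

lemma outer_mult: "outer u w *v y = (w \<bullet> y) *\<^sub>R u"
  by (simp add: vec_eq_iff outer_def matrix_vector_mult_def inner_vec_def sum_distrib_left
      mult.commute mult.left_commute)

text \<open>
  Equality in the preceding bound: with \<open>z = (y, -1)\<close>, subtract the rank-one matrix
  \<open>C z z\<^sup>T / \<parallel>z\<parallel>\<^sup>2\<close> from \<open>C = [A, b]\<close>.
\<close>

lemma rank_one_correction:
  fixes A :: "real^'n^'m"
  obtains A' b' where "A' *v y = b'"
    "norm (augment A b - augment A' b') * norm (extend y (- 1)) = norm (A *v y - b)"
proof
  define \<rho> where "\<rho> = 1 + y \<bullet> y"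
  define e where "e = A *v y - b"
  have \<rho>: "\<rho> > 0" by (simp add: \<rho>_def add_pos_nonneg)
  let ?A = "A - (1 / \<rho>) *\<^sub>R outer e y" and ?b = "b + (1 / \<rho>) *\<^sub>R e"
  have "?A *v y - ?b = e - ((y \<bullet> y) / \<rho> + 1 / \<rho>) *\<^sub>R e"
    by (simp add: e_def matrix_vector_mult_diff_rdistrib outer_mult scaleR_matrix_vector_assoc[symmetric]
        scaleR_add_left)
  also have "(y \<bullet> y) / \<rho> + 1 / \<rho> = 1"
    using \<rho> by (simp add: \<rho>_def add_divide_distrib[symmetric] add.commute)
  finally show "?A *v y = ?b" by simp
  have "(norm (augment A b - augment ?A ?b))\<^sup>2 =
      (norm ((1 / \<rho>) *\<^sub>R outer e y))\<^sup>2 + (norm ((1 / \<rho>) *\<^sub>R e))\<^sup>2"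
    by (simp add: augment_diff norm_augment norm_Pair)
  also have "\<dots> = (norm e / \<rho>)\<^sup>2 * \<rho>"
    by (simp add: norm_outer \<rho>_def power2_norm_eq_inner[symmetric] power_mult_distrib power_divide
        algebra_simps add_divide_distrib)
  also have "\<dots> = (norm e)\<^sup>2 / \<rho>" using \<rho> by (simp add: power2_eq_square)
  finally have "(norm (augment A b - augment ?A ?b) * norm (extend y (- 1)))\<^sup>2 = (norm e)\<^sup>2"
    using \<rho> by (simp add: power_mult_distrib norm_homogenized \<rho>_def)
  then show "norm (augment A b - augment ?A ?b) * norm (extend y (- 1)) = norm (A *v y - b)"
    by (simp add: power2_eq_iff_nonneg e_def)
qed

lemma is_tls_solution_iff_optimal:
  fixes A :: "real^'n^'m"
  assumes "tls_generic A b"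
  shows "is_tls_solution A b x \<longleftrightarrow> tls_optimal A b x"
proof
  assume "tls_optimal A b x"
  obtain A' b' where fit: "A' *v x = b'"
      "norm (augment A b - augment A' b') * norm (extend x (- 1)) = norm (A *v x - b)"
    by (rule rank_one_correction)
  then have level: "norm (augment A b - augment A' b') = tls_level A b"
    using \<open>tls_optimal A b x\<close> norm_homogenized_pos[of x] by (simp add: tls_optimal_def)
  have "is_tls_minimizer A b A' b'"
    unfolding is_tls_minimizer_def level
  proof (intro conjI allI impI)
    show "b' \<in> range ((*v) A')" using fit by blast
    fix A'' :: "real^'n^'m" and b'' assume "b'' \<in> range ((*v) A'')"
    then obtain y where "A'' *v y = b''" by blast
    from consistent_distance[OF this, of A b] tls_level_le[of A b y]
    have "tls_level A b * norm (extend y (- 1)) \<le>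
        norm (augment A b - augment A'' b'') * norm (extend y (- 1))" by linarith
    then show "tls_level A b \<le> norm (augment A b - augment A'' b'')"
      using norm_homogenized_pos[of y] by simp
  qed
  then show "is_tls_solution A b x" using fit by (auto simp: is_tls_solution_def)
next
  assume "is_tls_solution A b x"
  then obtain A' b' where min: "is_tls_minimizer A b A' b'" and x: "A' *v x = b'"
    by (auto simp: is_tls_solution_def)
  obtain y where y: "tls_optimal A b y" using tls_optimal_exists[OF assms] by blast
  obtain A'' b'' where fit: "A'' *v y = b''"
      "norm (augment A b - augment A'' b'') * norm (extend y (- 1)) = norm (A *v y - b)"
    by (rule rank_one_correction)
  then have "norm (augment A b - augment A'' b'') = tls_level A b"
    using y norm_homogenized_pos[of y] by (simp add: tls_optimal_def)
  then have "norm (augment A b - augment A' b') \<le> tls_level A b"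
    using min fit(1) by (metis is_tls_minimizer_def rangeI)
  then have "norm (augment A b - augment A' b') * norm (extend x (- 1)) \<le>
      tls_level A b * norm (extend x (- 1))" by (simp add: mult_right_mono)
  then show "tls_optimal A b x"
    using consistent_distance[OF x, of A b] tls_level_le[of A b x] by (simp add: tls_optimal_def)
qed

lemma tls_solution_optimal:
  assumes "tls_generic A b"
  shows "tls_optimal A b (tls_solution A b)"
proof -
  have "\<exists>!x. is_tls_solution A b x"
    using tls_optimal_exists[OF assms] tls_optimal_unique[OF assms]
    by (auto simp: is_tls_solution_iff_optimal[OF assms])
  then have "is_tls_solution A b (tls_solution A b)"
    unfolding tls_solution_def by (rule theI')
  then show ?thesis by (simp add: is_tls_solution_iff_optimal[OF assms])
qed

section \<open>Stationarity of the Rayleigh quotient\<close>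

text \<open>
  This is \<open>- (1 + x\<^sup>T x) / 2\<close> times the gradient of \<open>\<parallel>b - A x\<parallel>\<^sup>2 / (1 + x\<^sup>T x)\<close> in \<open>x\<close>. Written with the
  quotient in place of \<open>\<sigma>\<^sup>2\<close>, the normal equation involves only smooth functions of the data
  and of \<open>x\<close>.
\<close>

definition tls_gradient :: "real^'n^'m \<Rightarrow> real^'m \<Rightarrow> real^'n \<Rightarrow> real^'n" where
  "tls_gradient A b x = transpose A *v (b - A *v x) +
     (((b - A *v x) \<bullet> (b - A *v x)) / (1 + x \<bullet> x)) *\<^sub>R x"

lemma tls_optimal_quotient:
  assumes "tls_optimal A b x"
  shows "((b - A *v x) \<bullet> (b - A *v x)) / (1 + x \<bullet> x) = (tls_level A b)\<^sup>2"
proof -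
  have "1 + x \<bullet> x \<noteq> 0" by (metis add_pos_nonneg inner_ge_zero less_irrefl zero_less_one)
  then show ?thesis
    using tls_optimal_sq[OF assms] by (simp add: power2_norm_eq_inner[symmetric] norm_minus_commute)
qed

lemma transpose_inner: "(transpose A *v u) \<bullet> y = u \<bullet> (A *v y)" for A :: "real^'n^'m"
  by (metis dot_lmul_matrix vector_transpose_matrix transpose_transpose)

lemma tls_normal_equation:
  assumes "tls_optimal A b x"
  shows "transpose A *v (b - A *v x) + (tls_level A b)\<^sup>2 *\<^sub>R x = 0"
proof -
  have "(transpose A *v (b - A *v x) + (tls_level A b)\<^sup>2 *\<^sub>R x) \<bullet> y = 0" for y
    unfolding inner_add_left transpose_inner
    using tls_optimal_orthogonality[OF assms, of y 0] by (simp add: inner_diff_left)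
  then show ?thesis by (metis inner_eq_zero_iff)
qed

lemma tls_gradient_zero:
  assumes "tls_optimal A b x"
  shows "tls_gradient A b x = 0"
  unfolding tls_gradient_def tls_optimal_quotient[OF assms] by (rule tls_normal_equation[OF assms])

section \<open>Continuous dependence on the data\<close>

lemma residual_perturbation:
  "norm (A *v y - b) \<le> norm (A' *v y - b') + norm ((A', b') - (A, b)) * norm (extend y (- 1))"
  for A A' :: "real^'n^'m"
proof -
  have "A *v y - b = (A' *v y - b') + (augment A b - augment A' b') *v extend y (- 1)"
    by (simp add: matrix_vector_mult_diff_rdistrib augment_mult_homogenized)
  then have "norm (A *v y - b) \<le>
      norm (A' *v y - b') + norm ((augment A b - augment A' b') *v extend y (- 1))"
    by (simp only: norm_triangle_ineq)
  also have "norm ((augment A b - augment A' b') *v extend y (- 1)) \<le>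
      norm (augment A b - augment A' b') * norm (extend y (- 1))"
    by (rule norm_matrix_vector_mult_le)
  also have "norm (augment A b - augment A' b') = norm ((A', b') - (A, b))"
    unfolding augment_diff norm_augment by (subst norm_minus_commute) simp
  finally show ?thesis by simp
qed

lemma tls_level_perturbation:
  "tls_level A' b' \<le> tls_level A b + norm ((A', b') - (A, b))"
  using smallest_singular_value_lipschitz[of "augment A' b'" "augment A b"]
  by (simp add: augment_diff norm_augment)

text \<open>
  Both singular values in the genericity condition are Lipschitz functions of the data.
\<close>

lemma eventually_generic:
  fixes A :: "real^'n^'m"
  assumes "tls_generic A b"
  shows "eventually (\<lambda>d. tls_generic (fst d) (snd d)) (nhds (A, b))"
proof -
  define g where "g = (smallest_singular_value A - tls_level A b) / 2"
  have "g > 0" using assms by (simp add: g_def tls_generic_def)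
  have "tls_generic (fst d) (snd d)" if "dist d (A, b) < g" for d
  proof -
    obtain A' b' where d: "d = (A', b')" by force
    have "norm (A - A') \<le> dist d (A, b)"
      using dist_fst_le[of d "(A, b)"] by (simp add: d dist_norm norm_minus_commute)
    then have "smallest_singular_value A \<le> smallest_singular_value A' + dist d (A, b)"
      using smallest_singular_value_lipschitz[of A A'] by linarith
    moreover have "tls_level A' b' \<le> tls_level A b + dist d (A, b)"
      using tls_level_perturbation[of A' b' A b] by (simp add: d dist_norm)
    ultimately show ?thesis using that by (simp add: d tls_generic_def g_def field_simps)
  qed
  then show ?thesis using \<open>g > 0\<close> by (auto simp: eventually_nhds_metric)
qed

text \<open>
  The solution \<open>x'\<close> for nearby data is nearly optimal for the original data: its residual quotient is
  at most \<open>\<sigma> + 2 \<delta>\<close>, one \<open>\<delta>\<close> each for moving the residual and the optimal value. By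
  \<open>tls_residual_gap\<close> near-optimality bounds the distance to \<open>x\<close>; the norm of \<open>x'\<close> that enters
  is absorbed by the smallness of \<open>\<epsilon>\<close>.
\<close>

lemma tls_optimal_stability:
  fixes A :: "real^'n^'m"
  assumes gen: "tls_generic A b" and x: "tls_optimal A b x" and x': "tls_optimal A' b' x'"
  defines "\<gamma> \<equiv> (smallest_singular_value A)\<^sup>2 - (tls_level A b)\<^sup>2"
    and "\<delta> \<equiv> norm ((A', b') - (A, b))"
  defines "\<epsilon> \<equiv> 4 * tls_level A b * \<delta> + 4 * \<delta>\<^sup>2"
  assumes small: "4 * \<epsilon> \<le> \<gamma>"
  shows "\<gamma> * (norm (x' - x))\<^sup>2 \<le> 2 * \<epsilon> * (1 + 2 * (x \<bullet> x))"
proof -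
  let ?s = "tls_level A b" and ?z = "norm (extend x' (- 1))" and ?h = "norm (x' - x)"
  have nonneg: "0 \<le> ?s" "0 \<le> \<delta>" "0 \<le> \<epsilon>"
    by (auto simp: smallest_singular_value_nonneg \<delta>_def \<epsilon>_def)
  have "norm (A *v x' - b) \<le> norm (A' *v x' - b') + \<delta> * ?z"
    unfolding \<delta>_def by (rule residual_perturbation)
  also have "norm (A' *v x' - b') \<le> (?s + \<delta>) * ?z"
    using x' tls_level_perturbation[of A' b' A b]
    by (simp add: tls_optimal_def \<delta>_def mult_right_mono)
  finally have "norm (A *v x' - b) \<le> (?s + 2 * \<delta>) * ?z" by (simp add: algebra_simps)
  then have "(norm (A *v x' - b))\<^sup>2 \<le> ((?s + 2 * \<delta>) * ?z)\<^sup>2" by (rule power_mono) simp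
  also have "\<dots> = (?s\<^sup>2 + \<epsilon>) * (1 + x' \<bullet> x')"
    unfolding power_mult_distrib norm_homogenized
    by (simp add: \<epsilon>_def power2_eq_square algebra_simps)
  finally have "(norm (A *v (x' - x)))\<^sup>2 - ?s\<^sup>2 * ?h\<^sup>2 \<le> \<epsilon> * (1 + x' \<bullet> x')"
    using tls_residual_gap[OF x, of x'] by (simp add: algebra_simps)
  then have "\<gamma> * ?h\<^sup>2 \<le> \<epsilon> * (1 + x' \<bullet> x')"
    using generic_coercive(2)[OF gen, of "x' - x"] by (simp add: \<gamma>_def left_diff_distrib)
  also have "\<dots> \<le> \<epsilon> * (1 + (2 * (x \<bullet> x) + 2 * ?h\<^sup>2))"
  proof (intro mult_left_mono add_left_mono)
    \<comment> \<open>\<open>2 \<parallel>x\<parallel>\<^sup>2 + 2 \<parallel>x' - x\<parallel>\<^sup>2 - \<parallel>x'\<parallel>\<^sup>2 = \<parallel>x' - 2 x\<parallel>\<^sup>2\<close>\<close>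
    have "0 \<le> (norm (x' - 2 *\<^sub>R x))\<^sup>2" by simp
    then show "x' \<bullet> x' \<le> 2 * (x \<bullet> x) + 2 * ?h\<^sup>2"
      by (simp add: power2_norm_eq_inner inner_diff inner_commute)
  qed (use nonneg in auto)
  finally have "\<gamma> * ?h\<^sup>2 \<le> \<epsilon> * (1 + 2 * (x \<bullet> x)) + 2 * \<epsilon> * ?h\<^sup>2" by (simp add: algebra_simps)
  moreover have "4 * \<epsilon> * ?h\<^sup>2 \<le> \<gamma> * ?h\<^sup>2" using small by (intro mult_right_mono) auto
  ultimately show ?thesis by (simp add: algebra_simps)
qed

lemma isCont_tls_solution:
  fixes A :: "real^'n^'m"
  assumes gen: "tls_generic A b"
  shows "isCont (\<lambda>(A, b). tls_solution A b) (A, b)"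
proof -
  let ?X = "\<lambda>d. tls_solution (fst d) (snd d)" and ?F = "nhds (A, b)"
  define x where "x = tls_solution A b"
  define \<gamma> where "\<gamma> = (smallest_singular_value A)\<^sup>2 - (tls_level A b)\<^sup>2"
  define \<epsilon> where "\<epsilon> d = 4 * tls_level A b * norm (d - (A, b)) + 4 * (norm (d - (A, b)))\<^sup>2" for d
  have "\<gamma> > 0" using generic_coercive(1)[OF gen] by (simp add: \<gamma>_def)
  have x: "tls_optimal A b x" unfolding x_def by (rule tls_solution_optimal[OF gen])
  have lim: "(\<epsilon> \<longlongrightarrow> 0) ?F"
  proof -
    have "(\<epsilon> \<longlongrightarrow> 4 * tls_level A b * norm ((A, b) - (A, b)) + 4 * (norm ((A, b) - (A, b)))\<^sup>2) ?F"
      unfolding \<epsilon>_def by (intro tendsto_intros filterlim_ident)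
    then show ?thesis by simp
  qed
  have "eventually (\<lambda>d. \<epsilon> d < \<gamma> / 4) ?F"
    using lim \<open>\<gamma> > 0\<close> by (intro order_tendstoD(2)[OF lim]) simp
  then have ev: "eventually (\<lambda>d. norm (?X d - x) \<le> sqrt (2 * \<epsilon> d * (1 + 2 * (x \<bullet> x)) / \<gamma>)) ?F"
    using eventually_generic[OF gen]
  proof eventually_elim
    case (elim d)
    obtain A' b' where d: "d = (A', b')" by force
    have "\<gamma> * (norm (?X d - x))\<^sup>2 \<le> 2 * \<epsilon> d * (1 + 2 * (x \<bullet> x))"
      unfolding \<gamma>_def \<epsilon>_def d
      using elim tls_optimal_stability[OF gen x tls_solution_optimal, of A' b']
      by (simp add: d \<gamma>_def \<epsilon>_def)
    then show ?case
      using \<open>\<gamma> > 0\<close> by (intro real_le_rsqrt) (simp add: pos_le_divide_eq mult.commute)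
  qed
  have "((\<lambda>d. sqrt (2 * \<epsilon> d * (1 + 2 * (x \<bullet> x)) / \<gamma>)) \<longlongrightarrow> sqrt (2 * 0 * (1 + 2 * (x \<bullet> x)) / \<gamma>)) ?F"
    using \<open>\<gamma> > 0\<close> by (intro tendsto_intros lim) auto
  then have "((\<lambda>d. ?X d - x) \<longlongrightarrow> 0) ?F"
    by (intro Lim_null_comparison[OF ev]) simp
  then have "(?X \<longlongrightarrow> x) ?F" by (rule LIM_zero_cancel)
  then have "(?X \<longlongrightarrow> x) (at (A, b))" by (rule tendsto_mono[OF at_within_le_nhds])
  then show ?thesis by (simp add: isCont_def x_def case_prod_unfold)
qed

section \<open>Differentiability\<close>

text \<open>
  The differentiability half of the implicit function theorem: for an implicit function already known
  to be continuous, differentiability of \<open>G\<close> at the single point suffices. Applying the left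
  inverse \<open>K\<close> to the expansion of \<open>G (y, g y) = 0\<close> leaves an error \<open>o(\<parallel>y - a\<parallel> + \<parallel>g y - g a\<parallel>)\<close>.
  A first use of this estimate shows \<open>g y - g a = O(\<parallel>y - a\<parallel>)\<close>, after which the error is
  \<open>o(\<parallel>y - a\<parallel>)\<close>.
\<close>

lemma implicit_function_derivative:
  fixes g :: "'a::real_normed_vector \<Rightarrow> 'b::real_normed_vector"
    and G :: "'a \<times> 'b \<Rightarrow> 'c::real_normed_vector"
  assumes der: "(G has_derivative (\<lambda>(u, w). Gu u + Gw w)) (at (a, g a))"
    and zero: "eventually (\<lambda>y. G (y, g y) = 0) (nhds a)"
    and cont: "isCont g a"
    and "bounded_linear Gu"
    and K: "bounded_linear K" "\<And>w. K (Gw w) = w"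
  shows "(g has_derivative (\<lambda>u. - K (Gu u))) (at a)"
proof -
  interpret K: bounded_linear K by fact
  let ?D = "\<lambda>(u, w). Gu u + Gw w"
  have blKG: "bounded_linear (\<lambda>u. K (Gu u))"
    using bounded_linear_compose[OF K(1) \<open>bounded_linear Gu\<close>] .
  obtain B where B: "B > 0" "\<And>w. norm (K w) \<le> norm w * B" using K.pos_bounded by blast
  obtain C where C: "C > 0" "\<And>u. norm (K (Gu u)) \<le> norm u * C"
    using bounded_linear.pos_bounded[OF blKG] by blast
  show ?thesis
    unfolding has_derivative_at_alt
  proof (intro conjI allI impI)
    show "bounded_linear (\<lambda>u. - K (Gu u))" using blKG by (rule bounded_linear_minus)
    fix e :: real assume "e > 0"
    \<comment> \<open>the first bound permits absorbing half of \<open>\<parallel>g y - g a\<parallel>\<close>, the second yields the final error\<close>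
    define \<eta> where "\<eta> = min (1 / (2 * B)) (e / (B * (2 * C + 2)))"
    have "B * (2 * C + 2) > 0" using B C by simp
    then have \<eta>: "\<eta> > 0" using B C \<open>e > 0\<close> by (simp add: \<eta>_def)
    have "\<eta> * (2 * B) \<le> 1" "\<eta> * (B * (2 * C + 2)) \<le> e"
      using B \<open>B * (2 * C + 2) > 0\<close> by (auto simp: \<eta>_def simp flip: pos_le_divide_eq)
    then have \<eta>_le: "B * \<eta> \<le> 1 / 2" "B * \<eta> * (2 * C + 2) \<le> e"
      by (simp_all only: mult_ac)
    have "eventually (\<lambda>p. norm (G p - G (a, g a) - ?D (p - (a, g a))) \<le> \<eta> * norm (p - (a, g a))) (nhds (a, g a))"
      using der \<eta> unfolding has_derivative_at_alt eventually_nhds_metric dist_norm by blast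
    moreover have "filterlim (\<lambda>y. (y, g y)) (nhds (a, g a)) (nhds a)"
      using cont by (intro tendsto_Pair filterlim_ident)
        (simp add: isCont_def tendsto_at_iff_tendsto_nhds)
    ultimately have "eventually (\<lambda>y. norm (G (y, g y) - G (a, g a) - ?D ((y, g y) - (a, g a))) \<le> \<eta> * norm ((y, g y) - (a, g a))) (nhds a)"
      by (rule eventually_compose_filterlim)
    then have "eventually (\<lambda>y. norm (g y - g a - - K (Gu (y - a))) \<le> e * norm (y - a)) (nhds a)"
      using zero
    proof eventually_elim
      case (elim y)
      let ?u = "y - a" and ?h = "g y - g a"
      have "G (a, g a) = 0" using eventually_nhds_x_imp_x[OF zero] .
      then have "norm (- (Gu ?u + Gw ?h)) \<le> \<eta> * norm (?u, ?h)"
        using elim by simp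
      then have "norm (Gu ?u + Gw ?h) \<le> \<eta> * norm (?u, ?h)"
        by (simp only: norm_minus_cancel)
      moreover have "norm (?u, ?h) \<le> norm ?u + norm ?h"
        by (rule norm_Pair_le)
      ultimately have "norm (Gu ?u + Gw ?h) \<le> \<eta> * (norm ?u + norm ?h)"
        using \<eta> by (meson mult_left_mono order.trans less_imp_le)
      then have "norm (K (Gu ?u + Gw ?h)) \<le> \<eta> * (norm ?u + norm ?h) * B"
        using B by (meson mult_right_mono order.trans less_imp_le)
      then have main: "norm (K (Gu ?u) + ?h) \<le> B * \<eta> * (norm ?u + norm ?h)"
        by (simp add: K.add K(2) mult.commute mult.left_commute)
      have "norm ?h \<le> norm (K (Gu ?u) + ?h) + norm (K (Gu ?u))"
        by (metis add.commute add_diff_cancel_right' norm_triangle_ineq4)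
      also have "\<dots> \<le> 1 / 2 * (norm ?u + norm ?h) + norm ?u * C"
        using main mult_right_mono[OF \<eta>_le(1) add_nonneg_nonneg[OF norm_ge_zero norm_ge_zero], of ?u ?h]
          C(2)[of ?u] by linarith
      finally have "norm ?u + norm ?h \<le> (2 * C + 2) * norm ?u" by (simp add: algebra_simps)
      then have "B * \<eta> * (norm ?u + norm ?h) \<le> B * \<eta> * ((2 * C + 2) * norm ?u)"
        using B \<eta> by (intro mult_left_mono) auto
      also have "\<dots> \<le> e * norm ?u"
        using mult_right_mono[OF \<eta>_le(2), of "norm ?u"] by (simp add: mult.assoc)
      finally show ?case using main by (simp add: add.commute)
    qed
    then show "\<exists>d>0. \<forall>y. norm (y - a) < d \<longrightarrow> norm (g y - g a - - K (Gu (y - a))) \<le> e * norm (y - a)"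
      by (auto simp: eventually_nhds_metric dist_norm)
  qed
qed

lemma bounded_bilinear_matrix_vector_mult:
  "bounded_bilinear ((*v) :: real^'n^'m \<Rightarrow> real^'n \<Rightarrow> real^'m)"
proof
  show "\<exists>K. \<forall>A y. norm ((A :: real^'n^'m) *v y) \<le> norm A * norm y * K"
    by (rule exI[of _ 1]) (simp add: norm_matrix_vector_mult_le)
qed (simp_all add: matrix_vector_mult_add_rdistrib matrix_vector_right_distrib
    scaleR_matrix_vector_assoc matrix_vector_mult_scaleR)

lemmas has_derivative_matrix_vector_mult [derivative_intros] =
  bounded_bilinear.FDERIV[OF bounded_bilinear_matrix_vector_mult]

lemma bounded_linear_transpose: "bounded_linear (transpose :: real^'n^'m \<Rightarrow> real^'m^'n)"
  unfolding linear_conv_bounded_linear[symmetric]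
  by (simp add: linear_iff transpose_def vec_eq_iff)

lemmas has_derivative_transpose [derivative_intros] =
  bounded_linear.has_derivative[OF bounded_linear_transpose]

text \<open>
  Differentiating the quotient in the direction \<open>w\<close> of \<open>x\<close> contributes a multiple of
  \<open>r\<^sup>T A w + \<sigma>\<^sup>2 x\<^sup>T w\<close>, which is zero by the normal equation. Only \<open>- P w\<close> is left in this direction,
  while the data direction yields the rank-one term of \<open>M\<close>.
\<close>

lemma tls_gradient_has_derivative:
  fixes A :: "real^'n^'m"
  assumes opt: "tls_optimal A b x"
  defines "r \<equiv> b - A *v x"
    and "P \<equiv> transpose A ** A - (tls_level A b)\<^sup>2 *\<^sub>R mat 1"
  defines "M \<equiv> transpose A + (2 / (1 + x \<bullet> x)) *\<^sub>R outer x r"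
  shows "((\<lambda>(d, y). tls_gradient (fst d) (snd d) y) has_derivative
    (\<lambda>(u, w). (transpose (fst u) *v r + M *v (snd u - fst u *v x)) + - (P *v w))) (at ((A, b), x))"
proof -
  define \<rho> where "\<rho> = 1 + x \<bullet> x"
  define q where "q = (r \<bullet> r) / \<rho>"
  have "\<rho> > 0" by (simp add: \<rho>_def add_pos_nonneg)
  have q: "q = (tls_level A b)\<^sup>2"
    using tls_optimal_quotient[OF opt] by (simp add: q_def \<rho>_def r_def)
  have normal: "r \<bullet> (A *v w) = - q * (x \<bullet> w)" for w
    using arg_cong[OF tls_normal_equation[OF opt], of "\<lambda>g. g \<bullet> w"]
    unfolding inner_add_left transpose_inner q r_def by simp
  define D where "D = (\<lambda>(u, w :: real^'n). transpose (fst u) *v r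
    + transpose A *v (snd u - (fst u *v x + A *v w)) + q *\<^sub>R w
    + ((2 * (r \<bullet> (snd u - (fst u *v x + A *v w))) * \<rho> - (r \<bullet> r) * (2 * (x \<bullet> w))) / (\<rho> * \<rho>)) *\<^sub>R x)"
  have "((\<lambda>(d, y). tls_gradient (fst d) (snd d) y) has_derivative D) (at ((A, b), x))"
    unfolding tls_gradient_def case_prod_unfold D_def
    by (rule derivative_eq_intros refl | use \<open>\<rho> > 0\<close> in \<open>simp add: \<rho>_def; fail\<close>)+
      (auto simp: fun_eq_iff r_def \<rho>_def q_def inner_commute algebra_simps)
  moreover have "D (u, w) = (transpose (fst u) *v r + M *v (snd u - fst u *v x)) + - (P *v w)" for u w
  proof -
    let ?e = "snd u - fst u *v x"
    have "2 * (r \<bullet> (?e - A *v w)) * \<rho> - (r \<bullet> r) * (2 * (x \<bullet> w)) = 2 * (r \<bullet> ?e) * \<rho>"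
      using \<open>\<rho> > 0\<close> by (simp add: inner_diff_right inner_add_right normal q_def field_simps)
    moreover have "M *v ?e = transpose A *v ?e + (2 * (r \<bullet> ?e) / \<rho>) *\<^sub>R x"
      by (simp add: M_def matrix_vector_mult_add_rdistrib scaleR_matrix_vector_assoc[symmetric]
          outer_mult \<rho>_def)
    moreover have "P *v w = transpose A *v (A *v w) - q *\<^sub>R w"
      by (simp add: P_def q matrix_vector_mult_diff_rdistrib matrix_vector_mul_assoc
          scaleR_matrix_vector_assoc[symmetric])
    ultimately show ?thesis
      using \<open>\<rho> > 0\<close> by (simp add: D_def diff_diff_eq[symmetric] matrix_vector_mult_diff_distrib)
  qed
  then have "D = (\<lambda>(u, w). (transpose (fst u) *v r + M *v (snd u - fst u *v x)) + - (P *v w))"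
    by (simp add: fun_eq_iff)
  ultimately show ?thesis by simp
qed

text \<open>
  A kernel vector \<open>y \<noteq> 0\<close> of \<open>P\<close> would satisfy \<open>\<parallel>A y\<parallel> = \<sigma> \<parallel>y\<parallel>\<close>, contrary to genericity.
\<close>

lemma shifted_gram_inverse:
  fixes A :: "real^'n^'m"
  assumes "tls_generic A b"
  defines "P \<equiv> transpose A ** A - (tls_level A b)\<^sup>2 *\<^sub>R mat 1"
  shows "matrix_inv P ** P = mat 1"
proof -
  have "y = 0" if "P *v y = 0" for y
  proof (rule generic_definite[OF assms(1)])
    have "(transpose A ** A) *v y = (tls_level A b)\<^sup>2 *\<^sub>R y"
      using that by (simp add: P_def matrix_vector_mult_diff_rdistrib
          scaleR_matrix_vector_assoc[symmetric])
    then have "(norm (A *v y))\<^sup>2 = (tls_level A b * norm y)\<^sup>2"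
      using gram_inner[of A y y] by (simp add: power2_norm_eq_inner power_mult_distrib)
    then show "norm (A *v y) \<le> tls_level A b * norm y"
      by (simp add: power2_eq_iff_nonneg smallest_singular_value_nonneg)
  qed
  then have "invertible P"
    by (metis invertible_left_inverse matrix_left_invertible_ker)
  then show ?thesis unfolding invertible_def matrix_inv_def by (metis (mono_tags, lifting) someI_ex)
qed

lemma bounded_linear_matrix_vector_left:
  "bounded_linear (\<lambda>A :: real^'n^'m. A *v y)"
  by (rule bounded_bilinear.bounded_linear_left[OF bounded_bilinear_matrix_vector_mult])

lemma bounded_linear_transpose_mult_left:
  "bounded_linear (\<lambda>A :: real^'n^'m. transpose A *v y)"
  by (rule bounded_linear_compose[OF bounded_linear_matrix_vector_left bounded_linear_transpose])

theorem tls_solution_has_derivative: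
  fixes A :: "real^'n^'m"
  assumes gen: "tls_generic A b"
  defines "x \<equiv> tls_solution A b"
  defines "r \<equiv> b - A *v x"
    and "P \<equiv> transpose A ** A - (tls_level A b)\<^sup>2 *\<^sub>R mat 1"
  defines "M \<equiv> transpose A + (2 / (1 + x \<bullet> x)) *\<^sub>R outer x r"
  shows "((\<lambda>(A, b). tls_solution A b) has_derivative
    (\<lambda>u. matrix_inv P *v (transpose (fst u) *v r + M *v (snd u - fst u *v x)))) (at (A, b))"
proof -
  let ?g = "\<lambda>(A, b). tls_solution A b :: real^'n"
  let ?G1 = "\<lambda>u. transpose (fst u) *v r + M *v (snd u - fst u *v x)"
  have opt: "tls_optimal A b x" unfolding x_def by (rule tls_solution_optimal[OF gen])
  have "(?g has_derivative (\<lambda>u. - (- (matrix_inv P *v ?G1 u)))) (at (A, b))"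
  proof (rule implicit_function_derivative[where K = "\<lambda>w. - (matrix_inv P *v w)" and Gw = "\<lambda>w. - (P *v w)"])
    show "((\<lambda>(d, y). tls_gradient (fst d) (snd d) y) has_derivative
        (\<lambda>(u, w). ?G1 u + - (P *v w))) (at ((A, b), ?g (A, b)))"
      using tls_gradient_has_derivative[OF opt] by (simp add: r_def P_def M_def x_def)
    show "eventually (\<lambda>d. (case (d, ?g d) of (d, y) \<Rightarrow> tls_gradient (fst d) (snd d) y) = 0) (nhds (A, b))"
      using eventually_generic[OF gen]
      by eventually_elim (auto intro!: tls_gradient_zero tls_solution_optimal)
    show "isCont ?g (A, b)" by (rule isCont_tls_solution[OF gen])
    show "bounded_linear ?G1"
      by (intro bounded_linear_add bounded_linear_sub bounded_linear_fst bounded_linear_snd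
          bounded_linear_compose[OF matrix_vector_mul_bounded_linear]
          bounded_linear_compose[OF bounded_linear_transpose_mult_left]
          bounded_linear_compose[OF bounded_linear_matrix_vector_left])
    show "bounded_linear (\<lambda>w. - (matrix_inv P *v w))"
      by (intro bounded_linear_minus matrix_vector_mul_bounded_linear)
    show "- (matrix_inv P *v - (P *v w)) = w" for w
      using shifted_gram_inverse[OF gen, folded P_def]
      by (simp add: linear_neg[OF matrix_vector_mul_linear] matrix_vector_mul_assoc)
  qed
  then show ?thesis by simp
qed

section \<open>The componentwise norm\<close>

text \<open>
  The admissible \<open>\<omega>\<close> form a closed set, so the least one exists whenever there is one at all, and
  they are closed upwards. Everything about the componentwise norm is derived from its upper
  bounds.
\<close>

lemma cnorm_le_iff: "cnorm w u \<le> ereal c \<longleftrightarrow> 0 \<le> c \<and> \<bar>u\<bar> \<le> c *\<^sub>R \<bar>w\<bar>"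
proof -
  let ?T = "{\<omega>::real. 0 \<le> \<omega> \<and> \<bar>u\<bar> \<le> \<omega> *\<^sub>R \<bar>w\<bar>}"
  show ?thesis
  proof (cases "?T = {}")
    case True
    then show ?thesis by (auto simp: cnorm_def)
  next
    case False
    have "?T = {0..} \<inter> (\<lambda>\<omega>. \<omega> *\<^sub>R \<bar>w\<bar>) -` {\<bar>u\<bar>..}" by auto
    then have "closed ?T"
      by (auto intro!: closed_Int closed_vimage continuous_intros)
    moreover have bdd: "bdd_below ?T" by (rule bdd_belowI[of _ 0]) simp
    ultimately have mem: "Inf ?T \<in> ?T" using False by (intro closed_contains_Inf)
    have least: "(LEAST \<omega>. 0 \<le> \<omega> \<and> \<bar>u\<bar> \<le> \<omega> *\<^sub>R \<bar>w\<bar>) = Inf ?T"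
      using mem bdd by (intro Least_equality) (auto intro: cInf_lower)
    have "cnorm w u = ereal (Inf ?T)"
      using mem unfolding cnorm_def least by auto
    moreover have "Inf ?T \<le> c \<longleftrightarrow> c \<in> ?T"
    proof
      assume le: "Inf ?T \<le> c"
      then have "Inf ?T *\<^sub>R \<bar>w\<bar> \<le> c *\<^sub>R \<bar>w\<bar>" by (intro scaleR_right_mono) auto
      then show "c \<in> ?T" using mem le by (auto intro: order_trans)
    qed (rule cInf_lower[OF _ bdd])
    ultimately show ?thesis by simp
  qed
qed

lemma ereal_eqI_upper_bounds:
  assumes "\<And>c. p \<le> ereal c \<longleftrightarrow> q \<le> ereal c"
  shows "p = q"
  using assms by (intro antisym) (rule ereal_le_real, simp)+

text \<open>
  The conventions for division by zero are such that this also holds for \<open>q = 0\<close>.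
\<close>

lemma quotient_le_iff: "ereal \<bar>p\<bar> / ereal \<bar>q\<bar> \<le> ereal c \<longleftrightarrow> 0 \<le> c \<and> \<bar>p\<bar> \<le> c * \<bar>q\<bar>"
proof (cases "q = 0")
  case True
  then show ?thesis by (cases "p = 0") (auto simp: divide_ereal_def)
next
  case False
  then have "\<bar>p\<bar> / \<bar>q\<bar> \<le> c \<longleftrightarrow> \<bar>p\<bar> \<le> c * \<bar>q\<bar>" by (simp add: pos_divide_le_eq)
  moreover have "0 \<le> c" if "\<bar>p\<bar> \<le> c * \<bar>q\<bar>"
    using that False by (metis abs_ge_zero order_trans zero_le_mult_iff abs_le_zero_iff)
  ultimately show ?thesis using False by auto
qed

lemma cnorm_eq_Max: "cnorm w u = Max (range (\<lambda>i. ereal \<bar>u $ i\<bar> / ereal \<bar>w $ i\<bar>))"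
  for w u :: "real^'k"
proof (rule ereal_eqI_upper_bounds)
  fix c :: real
  have "Max (range f) \<le> z \<longleftrightarrow> (\<forall>i. f i \<le> z)" for f :: "'k \<Rightarrow> ereal" and z
    by (subst Max_le_iff) auto
  then show "cnorm w u \<le> ereal c \<longleftrightarrow> Max (range (\<lambda>i. ereal \<bar>u $ i\<bar> / ereal \<bar>w $ i\<bar>)) \<le> ereal c"
    unfolding cnorm_le_iff by (simp only: quotient_le_iff) (auto simp: less_eq_vec_def abs_vec_def)
qed

lemma cnorm_eq_1:
  assumes "\<bar>u\<bar> = \<bar>w\<bar>" "w \<noteq> 0"
  shows "cnorm w u = 1"
proof -
  have "0 \<le> c \<and> \<bar>w\<bar> \<le> c *\<^sub>R \<bar>w\<bar> \<longleftrightarrow> 1 \<le> c" for c :: real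
  proof
    assume le: "0 \<le> c \<and> \<bar>w\<bar> \<le> c *\<^sub>R \<bar>w\<bar>"
    obtain i where i: "i \<in> Basis" "w \<bullet> i \<noteq> 0"
      using \<open>w \<noteq> 0\<close> euclidean_eq_iff[of w 0] by auto
    have "\<bar>w \<bullet> i\<bar> \<le> c * \<bar>w \<bullet> i\<bar>"
      using inner_Basis_mono[OF conjunct2[OF le] i(1)] i(1) by (simp add: abs_inner)
    then show "1 \<le> c" using i(2) by simp
  next
    assume "1 \<le> c"
    then show "0 \<le> c \<and> \<bar>w\<bar> \<le> c *\<^sub>R \<bar>w\<bar>"
      using scaleR_right_mono[of 1 c "\<bar>w\<bar>"] by simp
  qed
  then have "cnorm w u = ereal 1"
    by (intro ereal_eqI_upper_bounds) (simp add: cnorm_le_iff assms(1))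
  then show ?thesis by simp
qed

section \<open>The Moore--Penrose inverse of a diagonal matrix\<close>

text \<open>
  Both \<open>M X\<close> and \<open>M Y\<close> are the orthogonal projection onto the range of \<open>M\<close>, and both \<open>X M\<close> and
  \<open>Y M\<close> are the orthogonal projection along its kernel. So \<open>X = X M X = X M Y = Y M Y = Y\<close>.
\<close>

lemma penrose_unique:
  fixes M :: "real^'n^'m"
  assumes X: "M ** X ** M = M" "X ** M ** X = X"
      "transpose (M ** X) = M ** X" "transpose (X ** M) = X ** M"
    and Y: "M ** Y ** M = M" "Y ** M ** Y = Y"
      "transpose (M ** Y) = M ** Y" "transpose (Y ** M) = Y ** M"
  shows "X = Y"
proof -
  have "M ** X = transpose ((M ** Y ** M) ** X)" using X Y by simp
  also have "\<dots> = (M ** X) ** (M ** Y)"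
    by (simp add: matrix_mul_assoc[symmetric] matrix_transpose_mul X Y)
      (metis X(3) Y(3) matrix_mul_assoc matrix_transpose_mul)
  also have "\<dots> = M ** Y" by (simp add: matrix_mul_assoc X)
  finally have MX: "M ** X = M ** Y" .
  have "X ** M = transpose (X ** (M ** Y ** M))" using X Y by simp
  also have "\<dots> = (Y ** M) ** (X ** M)"
    by (metis X(4) Y(4) matrix_mul_assoc matrix_transpose_mul)
  also have "\<dots> = Y ** M" by (metis X(1) matrix_mul_assoc)
  finally have XM: "X ** M = Y ** M" .
  show "X = Y" by (metis MX XM X(2) Y(2) matrix_mul_assoc)
qed

lemma diag_mult: "(diag d *v u) $ i = d $ i * u $ i"
  by (simp add: diag_def matrix_vector_mult_def if_distrib[where f = "\<lambda>t. t * _"] cong: if_cong)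

lemma diag_mult_diag: "diag d ** diag e = diag (\<chi> i. d $ i * e $ i)"
  by (simp add: diag_def matrix_matrix_mult_def vec_eq_iff if_distrib[where f = "\<lambda>t. t * _"] cong: if_cong)

lemma transpose_diag: "transpose (diag d) = diag d"
  by (auto simp: diag_def transpose_def vec_eq_iff)

lemma pinv_diag: "pinv (diag d) = diag (\<chi> i. inverse (d $ i))"
proof -
  let ?X = "diag (\<chi> i. inverse (d $ i))"
  have cancel: "t * inverse t * t = t" "inverse t * t * inverse t = inverse t" for t :: real
    by (cases "t = 0"; simp)+
  have "diag d ** ?X ** diag d = diag d" "?X ** diag d ** ?X = ?X"
    "transpose (diag d ** ?X) = diag d ** ?X" "transpose (?X ** diag d) = ?X ** diag d"
    by (simp_all only: diag_mult_diag transpose_diag vec_lambda_beta cancel vec_lambda_eta)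
  then show ?thesis
    unfolding pinv_def by (intro the_equality conjI) (auto intro: penrose_unique)
qed

section \<open>Componentwise condition number of a linear map\<close>

lemma infnorm_cart_attained: "\<exists>i. infnorm x = \<bar>x $ i\<bar>" for x :: "real^'k"
proof -
  have "infnorm x = Max (range (\<lambda>i. \<bar>x $ i\<bar>))"
    unfolding infnorm_cart by (subst cSup_eq_Max[symmetric]) (auto simp: full_SetCompr_eq)
  also have "\<dots> \<in> range (\<lambda>i. \<bar>x $ i\<bar>)" by (rule Max_in) auto
  finally show ?thesis by (simp add: image_iff)
qed

lemma abs_matrix_vector_le:
  fixes B :: "real^'q^'k"
  assumes "\<bar>u\<bar> \<le> \<bar>a\<bar>"
  shows "\<bar>(B *v u) $ i\<bar> \<le> (\<bar>B\<bar> *v \<bar>a\<bar>) $ i"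
proof -
  have "\<bar>(B *v u) $ i\<bar> \<le> (\<Sum>j\<in>UNIV. \<bar>B $ i $ j * u $ j\<bar>)"
    by (simp add: matrix_vector_mult_def sum_abs)
  also have "\<dots> \<le> (\<Sum>j\<in>UNIV. \<bar>B $ i $ j\<bar> * \<bar>a $ j\<bar>)"
    using assms by (intro sum_mono) (auto simp: abs_mult less_eq_vec_def abs_vec_def intro!: mult_left_mono)
  finally show ?thesis by (simp add: matrix_vector_mult_def abs_vec_def)
qed

text \<open>
  The signs of the entries of \<open>u\<close> can be matched to those in a single row \<open>i\<close> of \<open>B\<close>.
\<close>

lemma abs_matrix_vector_attained:
  fixes B :: "real^'q^'k"
  obtains u where "\<bar>u\<bar> = \<bar>a\<bar>" "(B *v u) $ i = (\<bar>B\<bar> *v \<bar>a\<bar>) $ i"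
proof
  let ?u = "\<chi> j. if B $ i $ j * a $ j < 0 then - a $ j else a $ j"
  show "\<bar>?u\<bar> = \<bar>a\<bar>" by (simp add: abs_vec_def vec_eq_iff)
  show "(B *v ?u) $ i = (\<bar>B\<bar> *v \<bar>a\<bar>) $ i"
    by (auto simp: matrix_vector_mult_def abs_vec_def abs_mult[symmetric] intro!: sum.cong)
qed

text \<open>
  All perturbations of norm \<open>1\<close> satisfy the entrywise bound; conversely perturbations with
  \<open>\<bar>da\<bar> = \<bar>a\<bar>\<close> and \<open>\<bar>db\<bar> = \<bar>b\<bar>\<close> have norm \<open>1\<close> because the data do not vanish, and their signs can be
  chosen for the row in which the maximum norm is attained. In rows with \<open>w\<^sub>i = 0\<close> both sides
  contribute \<open>0\<close>, the left one by the convention and the right one since the pseudoinverse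
  vanishes there.
\<close>

lemma Greatest_cnorm_linear:
  fixes B :: "real^'q^'k" and K :: "real^'m^'k" and w :: "real^'k"
  assumes nz: "(a, b) \<noteq> 0"
    and zero: "\<And>i da db. w $ i = 0 \<Longrightarrow> cnorm (a, b) (da, db) < \<infinity> \<Longrightarrow> (B *v da + K *v db) $ i = 0"
  shows "(GREATEST \<kappa>. \<exists>da db. cnorm (a, b) (da, db) = 1 \<and> \<kappa> = cnorm w (B *v da + K *v db)) =
    ereal (infnorm (pinv (diag w) *v (\<bar>B\<bar> *v \<bar>a\<bar> + \<bar>K\<bar> *v \<bar>b\<bar>)))"
proof -
  let ?h = "\<bar>B\<bar> *v \<bar>a\<bar> + \<bar>K\<bar> *v \<bar>b\<bar>"
  let ?c = "pinv (diag w) *v ?h"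
  have c: "?c $ i = ?h $ i / w $ i" for i
    by (simp add: pinv_diag diag_mult field_simps)
  have upper: "cnorm w (B *v da + K *v db) \<le> ereal (infnorm ?c)"
    if one: "cnorm (a, b) (da, db) = 1" for da db
    unfolding cnorm_le_iff less_eq_vec_def
  proof (intro conjI allI infnorm_pos_le)
    fix i
    have "cnorm (a, b) (da, db) \<le> ereal 1" using one by simp
    then have "\<bar>da\<bar> \<le> \<bar>a\<bar>" "\<bar>db\<bar> \<le> \<bar>b\<bar>" unfolding cnorm_le_iff by (auto simp: abs_prod_def)
    then have le: "\<bar>(B *v da + K *v db) $ i\<bar> \<le> ?h $ i"
      using abs_matrix_vector_le[of da a B i] abs_matrix_vector_le[of db b K i] by simp
    show "\<bar>B *v da + K *v db\<bar> $ i \<le> (infnorm ?c *\<^sub>R \<bar>w\<bar>) $ i"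
    proof (cases "w $ i = 0")
      case True
      then show ?thesis using zero[OF True, of da db] one by (simp add: abs_vec_def)
    next
      case False
      have "?h $ i \<le> \<bar>?c $ i\<bar> * \<bar>w $ i\<bar>"
        unfolding c abs_mult[symmetric] using False by simp
      also have "\<dots> \<le> infnorm ?c * \<bar>w $ i\<bar>"
        by (intro mult_right_mono component_le_infnorm_cart) simp
      finally show ?thesis using le by (simp add: abs_vec_def)
    qed
  qed
  obtain i where i: "infnorm ?c = \<bar>?c $ i\<bar>" using infnorm_cart_attained by blast
  obtain da where da: "\<bar>da\<bar> = \<bar>a\<bar>" "(B *v da) $ i = (\<bar>B\<bar> *v \<bar>a\<bar>) $ i"
    by (rule abs_matrix_vector_attained)
  obtain db where db: "\<bar>db\<bar> = \<bar>b\<bar>" "(K *v db) $ i = (\<bar>K\<bar> *v \<bar>b\<bar>) $ i"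
    by (rule abs_matrix_vector_attained)
  have one: "cnorm (a, b) (da, db) = 1"
    using da db nz by (intro cnorm_eq_1) (auto simp: abs_prod_def)
  have "ereal (infnorm ?c) \<le> cnorm w (B *v da + K *v db)"
  proof (rule ereal_le_real)
    fix e assume "cnorm w (B *v da + K *v db) \<le> ereal e"
    then have e: "0 \<le> e" "\<bar>?h $ i\<bar> \<le> e * \<bar>w $ i\<bar>"
      using da db by (auto simp: cnorm_le_iff less_eq_vec_def abs_vec_def dest: spec[of _ i])
    then show "ereal (infnorm ?c) \<le> ereal e"
      unfolding i c by (cases "w $ i = 0") (auto simp: abs_divide pos_divide_le_eq)
  qed
  then have "cnorm w (B *v da + K *v db) = ereal (infnorm ?c)"
    using upper[OF one] by simp
  then show ?thesis
    using one upper by (intro Greatest_equality) metis+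
qed

section \<open>Structured perturbations\<close>

lemma bounded_linear_structured: "bounded_linear (structured S)"
  unfolding structured_def
  by (intro bounded_linear_sum bounded_linear_scaleR_const bounded_linear_vec_nth)

lemma Psi_has_derivative:
  fixes S :: "'q::finite \<Rightarrow> real^'n^'m" and L :: "real^'n^'k"
  assumes gen: "tls_generic (structured S a) b"
  defines "A \<equiv> structured S a"
  defines "x \<equiv> tls_solution A b"
  defines "r \<equiv> b - A *v x"
    and "P \<equiv> transpose A ** A - (tls_level A b)\<^sup>2 *\<^sub>R mat 1"
  defines "M \<equiv> transpose A + (2 / (1 + x \<bullet> x)) *\<^sub>R outer x r"
  shows "(Psi S L has_derivative
    (\<lambda>d. L *v (matrix_inv P *v (transpose (structured S (fst d)) *v r +
      M *v (snd d - structured S (fst d) *v x))))) (at (a, b))"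
proof -
  let ?I = "\<lambda>d. (structured S (fst d), snd d)"
  have I: "(?I has_derivative ?I) (at (a, b))"
    by (intro bounded_linear_imp_has_derivative bounded_linear_Pair bounded_linear_snd
        bounded_linear_compose[OF bounded_linear_structured] bounded_linear_fst)
  have g: "((\<lambda>(A, b). tls_solution A b) has_derivative
      (\<lambda>u. matrix_inv P *v (transpose (fst u) *v r + M *v (snd u - fst u *v x)))) (at (?I (a, b)))"
    using tls_solution_has_derivative[OF gen] by (simp add: A_def x_def r_def P_def M_def)
  show ?thesis
    using bounded_linear.has_derivative[OF matrix_vector_mul_bounded_linear has_derivative_compose[OF I g], of L]
    by (simp add: Psi_def case_prod_unfold)
qed

text \<open>
  Otherwise \<open>A\<close> would have smallest singular value \<open>0\<close>, and the singular value \<open>\<sigma>\<close> of \<open>[A, b]\<close>,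
  being nonnegative, could not be smaller.
\<close>

lemma generic_imp_nonzero:
  assumes "tls_generic A b"
  shows "A \<noteq> 0"
proof
  assume "A = 0"
  have "(1 :: real^'n) \<noteq> 0" by simp
  then show False
    using generic_definite[OF assms, of 1] \<open>A = 0\<close> by (simp add: smallest_singular_value_nonneg)
qed

text \<open>
  Up to the factor \<open>P\<^sup>-\<^sup>1\<close> this is the derivative of the solution in a structured direction. It is linear
  in the coefficients, so its matrix has the images of the basis matrices \<open>S\<^sub>i\<close> as columns.
\<close>

lemma structured_direction:
  fixes S :: "'q::finite \<Rightarrow> real^'n^'m"
  shows "transpose (structured S u) *v r - M *v (structured S u *v x) =
    (\<chi> j i. (transpose (S i) *v r - M *v (S i *v x)) $ j) *v u"
proof -
  let ?f = "\<lambda>B :: real^'n^'m. transpose B *v r - M *v (B *v x)"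
  have "bounded_linear ?f"
    by (intro bounded_linear_sub bounded_linear_transpose_mult_left
        bounded_linear_compose[OF matrix_vector_mul_bounded_linear] bounded_linear_matrix_vector_left)
  then have lin: "linear ?f" by (rule bounded_linear.linear)
  have "?f (structured S u) = (\<Sum>i\<in>UNIV. ?f (u $ i *\<^sub>R S i))"
    unfolding structured_def by (rule linear_sum[OF lin])
  also have "\<dots> = (\<Sum>i\<in>UNIV. u $ i *\<^sub>R ?f (S i))"
    by (simp only: linear_scale[OF lin])
  also have "\<dots> = (\<chi> j i. ?f (S i) $ j) *v u"
    by (simp add: vec_eq_iff matrix_vector_mult_def mult.commute)
  finally show ?thesis .
qed

theorem corollary3p8:
  fixes S :: "'q::finite \<Rightarrow> real^'n::finite^'m::finite"
    and SS :: "(real^'n^'m) set"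
    and A :: "real^'n^'m" and a :: "real^'q" and b r :: "real^'m" and x :: "real^'n"
    and P :: "real^'n^'n" and L :: "real^'n^'k::finite"
    and v :: "'q \<Rightarrow> real^'n" and V N :: "real^'q^'n" and M H :: "real^'m^'n"
  assumes "CARD('m) > CARD('n)" and "CARD('k) \<le> CARD('n)"
    and "subspace SS" and "inj S" and "independent (range S)" and "span (range S) = SS"
    and "A = structured S a"
    and "tls_generic A b"
    and "x = tls_solution A b"
    and "r = b - A *v x"
    and "P = transpose A ** A - (smallest_singular_value (augment A b))\<^sup>2 *\<^sub>R mat 1"
    and "M = transpose A + (2 / (1 + x \<bullet> x)) *\<^sub>R outer x r"
    and "\<And>i. v i = transpose (S i) *v r - M *v (S i *v x)"
    and "V = (\<chi> j i. v i $ j)"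
    and "N = matrix_inv P ** V"
    and "H = matrix_inv P ** M"
    \<comment> \<open>convention on zero components of \<open>L x\<close>\<close>
    and "\<And>i da db. (L *v x) $ i = 0 \<Longrightarrow> cnorm (a, b) (da, db) < \<infinity> \<Longrightarrow>
           dPsi S L (a, b) (da, db) $ i = 0"
  shows
    \<comment> \<open>in \<^typ>\<open>ereal\<close>, \<open>0 / 0 = 0\<close>, and \<open>c / 0 = \<infinity>\<close> for \<open>c > 0\<close>\<close>
    "(\<forall>u. cnorm (L *v x) u = Max (range (\<lambda>i. ereal \<bar>u $ i\<bar> / ereal \<bar>(L *v x) $ i\<bar>))) \<and>
     cond_sc S L a b =
       ereal (infnorm (pinv (diag (L *v x)) *v (\<bar>L ** N\<bar> *v \<bar>a\<bar> + \<bar>L ** H\<bar> *v \<bar>b\<bar>))) \<and>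
     cond_sc S L a b =
       ereal (infnorm (pinv (diag (L *v x)) *v
         ((\<Sum>i\<in>UNIV. \<bar>a $ i\<bar> *\<^sub>R
             \<bar>(L ** matrix_inv P) *v (M *v (S i *v x) - transpose (S i) *v r)\<bar>)
          + \<bar>L ** matrix_inv P ** M\<bar> *v \<bar>b\<bar>)))"
proof -
  note A = assms(7) and gen = assms(8) and x = assms(9) and r = assms(10) and P = assms(11)
    and M = assms(12) and v = assms(13) and V = assms(14) and N = assms(15) and H = assms(16)
    and convention = assms(17)
  have Lx: "Psi S L (a, b) = L *v x" by (simp add: Psi_def A x)
  have V_mult: "V *v da = transpose (structured S da) *v r - M *v (structured S da *v x)" for da
    unfolding structured_direction V v ..
  have derivative: "dPsi S L (a, b) (da, db) = (L ** N) *v da + (L ** H) *v db" for da db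
  proof -
    have "dPsi S L (a, b) = (\<lambda>d. L *v (matrix_inv P *v (transpose (structured S (fst d)) *v r +
        M *v (snd d - structured S (fst d) *v x))))"
      using frechet_derivative_at[OF Psi_has_derivative[OF gen[unfolded A]], of L]
      unfolding P M r x A by simp
    then have "dPsi S L (a, b) (da, db) = L *v (matrix_inv P *v (V *v da + M *v db))"
      by (simp add: V_mult matrix_vector_mult_diff_distrib add_diff_eq diff_add_eq)
    then show ?thesis
      by (simp add: N H matrix_vector_right_distrib matrix_vector_mul_assoc matrix_mul_assoc)
  qed
  have "a \<noteq> 0"
    using generic_imp_nonzero[OF gen] by (auto simp: A structured_def)
  then have "(a, b) \<noteq> 0" by (simp add: zero_prod_def)
  then have cond: "cond_sc S L a b =
      ereal (infnorm (pinv (diag (L *v x)) *v (\<bar>L ** N\<bar> *v \<bar>a\<bar> + \<bar>L ** H\<bar> *v \<bar>b\<bar>)))"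
    unfolding cond_sc_def Lx derivative
    using convention unfolding derivative by (intro Greatest_cnorm_linear) auto
  have column: "(L ** N) $ k $ i =
      - ((L ** matrix_inv P) *v (M *v (S i *v x) - transpose (S i) *v r)) $ k" for k i
  proof -
    have "(L ** N) $ k $ i = ((L ** matrix_inv P) *v v i) $ k"
      by (simp add: N V matrix_mul_assoc) (simp add: matrix_matrix_mult_def matrix_vector_mult_def)
    also have "v i = - (M *v (S i *v x) - transpose (S i) *v r)" by (simp add: v)
    finally show ?thesis by (simp add: linear_neg[OF matrix_vector_mul_linear] del: minus_diff_eq)
  qed
  have "\<bar>L ** N\<bar> *v \<bar>a\<bar> = (\<Sum>i\<in>UNIV. \<bar>a $ i\<bar> *\<^sub>R
      \<bar>(L ** matrix_inv P) *v (M *v (S i *v x) - transpose (S i) *v r)\<bar>)"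
    unfolding matrix_vector_mult_def[of "\<bar>L ** N\<bar>"]
    by (simp add: vec_eq_iff abs_vec_def column mult.commute)
  then have "cond_sc S L a b = ereal (infnorm (pinv (diag (L *v x)) *v
      ((\<Sum>i\<in>UNIV. \<bar>a $ i\<bar> *\<^sub>R
          \<bar>(L ** matrix_inv P) *v (M *v (S i *v x) - transpose (S i) *v r)\<bar>)
        + \<bar>L ** matrix_inv P ** M\<bar> *v \<bar>b\<bar>)))"
    unfolding cond H by (simp only: matrix_mul_assoc)
  with cond show ?thesis by (intro conjI allI cnorm_eq_Max)
qed

end
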